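(* The branching times of the simplified model are quasi-Markov, in the following sense. Let $\lambda\ge 0$, $\varepsilon>0$, $\sigma=\sigma(\lambda,\varepsilon)$, and let $T\le t$ be real numbers. Let $q_{t,T}$ be a law whose restriction to $[0,t-T]$ is absolutely continuous with respect to Lebesgue measure with density $$s\mapsto \frac{e^{-s}\,\sigma\, v_\sigma(t-T-s)^2}{v_\sigma(t-T)},\qquad 0\le s\le t-T .$$ Then for every $0\le r\le t-T$ and all measurable sets $A_0,A_1\subset \mathbb{R}_+^{U}$, $$\widehat P_{\lambda,t-T}\Big(e_\emptyset\le r,\ (e_{0w})_{w\in U}\in A_0,\ (e_{1w})_{w\in U}\in A_1\Big)=\int_{0}^{r} q_{t,T}(ds)\ \widehat P_{\lambda,t-T-s}\big((e_w)_{w\in U}\in A_0\big)\ \widehat P_{\lambda,t-T-s}\big((e_w)_{w\in U}\in A_1\big).$$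
   Context: Let $U=\bigcup_{k\ge 0}\{0,1\}^k$ be the vertex set of the infinite rooted binary tree ($\emptyset$ is the root; $0w$, $1w$, $w\in U$, are the vertices of the two subtrees rooted at the children $0$ and $1$ of the root). Under $\mathbb{P}$, with expectation $\mathbb{E}$, the waiting times $(e_w)_{w\in U}$ are i.i.d. standard exponential random variables; $e_w$ is the time from the birth of $w$ to its branching (into its two children $w0$, $w1$). The root is born at time $0$, and each other vertex is born when its parent branches. This is the genealogical tree of binary branching Brownian motion. $n(h)$ denotes the number of vertices alive at time $h$, i.e. born at or before $h$ and branching after $h$. $\mathbb{R}_+^U$ carries the product $\sigma$-algebra. Set $\sigma(\lambda,\varepsilon)=\operatorname{sech}(\varepsilon\sqrt{2\lambda})$, $v_\sigma(h)=\mathbb{E}[\sigma^{n(h)-1}]$, and, for $h\ge0$, $\widehat P_{\lambda,h}(A)=\mathbb{E}[\mathbf 1_A\,\sigma(\lambda,\varepsilon)^{n(h)-1}]/v_{\sigma(\lambda,\varepsilon)}(h)$. Here $T$ is interpreted as the (absolute) birth time of the root of the tree under consideration, $t$ as the time horizon, and $\widehat P_{\lambda,t-T}$ as the law of the waiting times of this tree. *)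

theory Defs
  imports "HOL-Probability.Probability"
begin

text \<open>
  A vertex of the binary tree is a word over \<^typ>\<open>bool\<close> (\<^const>\<open>False\<close> for the letter 0,
  \<^const>\<open>True\<close> for 1), read from the root downwards: the children of \<open>w\<close> are \<open>w @ [i]\<close>, and
  \<open>i # w\<close> is the vertex \<open>w\<close> of the subtree rooted at the child \<open>[i]\<close> of the root.
\<close>

type_synonym vertex = "bool list"

definition birth_time :: "(vertex \<Rightarrow> real) \<Rightarrow> vertex \<Rightarrow> real" where
  "birth_time x w = (\<Sum>k<length w. x (take k w))"

lemma birth_time_root: "birth_time x [] = 0"
  by (simp add: birth_time_def)

lemma birth_time_child: "birth_time x (w @ [i]) = birth_time x w + x w"
  by (simp add: birth_time_def)

definition alive :: "(vertex \<Rightarrow> real) \<Rightarrow> real \<Rightarrow> vertex set" where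
  "alive x h = {w. birth_time x w \<le> h \<and> h < birth_time x w + x w}"

text \<open>
  For i.i.d. exponential waiting times and \<open>h \<ge> 0\<close>, almost surely \<open>alive x h\<close> is finite and
  nonempty, so the conventions for \<^const>\<open>card\<close> of an infinite set and for truncated
  subtraction in \<open>num_alive x h - 1\<close> below matter only on a null set.
\<close>

definition num_alive :: "(vertex \<Rightarrow> real) \<Rightarrow> real \<Rightarrow> nat" where
  "num_alive x h = card (alive x h)"

definition sigma_param :: "real \<Rightarrow> real \<Rightarrow> real" where
  "sigma_param l \<epsilon> = 1 / cosh (\<epsilon> * sqrt (2 * l))"

definition v_fun :: "'a measure \<Rightarrow> (vertex \<Rightarrow> 'a \<Rightarrow> real) \<Rightarrow> real \<Rightarrow> real \<Rightarrow> real" where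
  "v_fun M e s h = (\<integral>\<omega>. s ^ (num_alive (\<lambda>w. e w \<omega>) h - 1) \<partial>M)"

definition P_hat ::
  "'a measure \<Rightarrow> (vertex \<Rightarrow> 'a \<Rightarrow> real) \<Rightarrow> real \<Rightarrow> real \<Rightarrow> real \<Rightarrow> 'a set \<Rightarrow> real" where
  "P_hat M e l \<epsilon> h A =
    (\<integral>\<omega>. indicator A \<omega> * sigma_param l \<epsilon> ^ (num_alive (\<lambda>w. e w \<omega>) h - 1) \<partial>M)
      / v_fun M e (sigma_param l \<epsilon>) h"

text \<open>The product \<open>\<sigma>\<close>-algebra on the nonnegative real families indexed by the vertices;
  only its measurable sets are used.\<close>

definition waiting_space :: "(vertex \<Rightarrow> real) measure" where
  "waiting_space = Pi\<^sub>M UNIV (\<lambda>_. restrict_space borel {0..})"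

end

theory Submission
  imports Defs
begin

text \<open>
  Let \<open>h = t - T\<close>. If the root branches at time \<open>s \<le> h\<close>, then every vertex alive at time \<open>h\<close>
  lies in one of the two subtrees, where it is alive at the time \<open>h - s\<close> counted from the birth
  of that subtree. The population sizes therefore satisfy
  \<open>n(h) - 1 = 1 + (n\<^sub>0(h - s) - 1) + (n\<^sub>1(h - s) - 1)\<close>, and the tilting weight factorises:
  \<open>\<sigma> ^ (n(h) - 1) = \<sigma> * \<sigma> ^ (n\<^sub>0(h - s) - 1) * \<sigma> ^ (n\<^sub>1(h - s) - 1)\<close>
  (\<open>num_alive_after_branching\<close>). Under the law of the waiting times the first branching time, with
  density \<open>exp (- s)\<close>, and the two subtrees are independent, and each subtree is a copy of the whole
  tree (\<open>distr_graft\<close>). By Tonelli's theorem the unnormalised tilted mass of the event is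
  \<open>\<integral>\<^sub>0\<^sup>r exp (- s) * \<sigma> * F(h - s, A\<^sub>0) * F(h - s, A\<^sub>1) ds\<close>,
  where \<open>F(u, A)\<close> is the expectation of \<open>\<sigma> ^ (n(u) - 1)\<close> on the event \<open>A\<close>
  (\<open>tilted_mass_branching\<close>). Dividing by \<open>v\<^sub>\<sigma>(h)\<close>, and multiplying and dividing the integrand by
  the square of \<open>v\<^sub>\<sigma>(h - s)\<close>, turns this into the integral against the density of \<open>q\<close>.

  The counting identity needs both subtrees to have finite, nonempty populations. This holds
  at all times simultaneously outside a null set (\<open>AE_nonexplosive\<close>), because the sum of
  \<open>exp (- 2 b\<^sub>w)\<close> over all vertices \<open>w\<close> with birth times \<open>b\<^sub>w\<close> has finite expectation
  \<open>1 + 2/3 + (2/3)\<^sup>2 + \<dots>\<close>.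
\<close>

section \<open>The tree split at its root\<close>

definition subtree :: "bool \<Rightarrow> (vertex \<Rightarrow> real) \<Rightarrow> vertex \<Rightarrow> real" where
  "subtree i x w = x (i # w)"

definition graft :: "real \<Rightarrow> (vertex \<Rightarrow> real) \<Rightarrow> (vertex \<Rightarrow> real) \<Rightarrow> vertex \<Rightarrow> real" where
  "graft s x y w = (case w of [] \<Rightarrow> s | i # u \<Rightarrow> if i then y u else x u)"

lemma graft_simps [simp]:
  "graft s x y [] = s" "graft s x y (False # w) = x w" "graft s x y (True # w) = y w"
  by (simp_all add: graft_def)

lemma subtree_graft [simp]:
  "subtree False (graft s x y) = x" "subtree True (graft s x y) = y"
  by (simp_all add: subtree_def fun_eq_iff)

lemma birth_time_Cons: "birth_time x (i # w) = x [] + birth_time (subtree i x) w"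
  unfolding birth_time_def subtree_def by (simp add: sum.lessThan_Suc_shift del: sum.lessThan_Suc)

lemma alive_after_branching:
  assumes "x [] \<le> h"
  shows "alive x h = (\<Union>i. Cons i ` alive (subtree i x) (h - x []))"
proof -
  have root: "[] \<notin> alive x h"
    using assms by (simp add: alive_def birth_time_root)
  have child: "i # w \<in> alive x h \<longleftrightarrow> w \<in> alive (subtree i x) (h - x [])" for i w
    by (auto simp: alive_def birth_time_Cons) (auto simp: subtree_def)
  show ?thesis
  proof (rule set_eqI)
    fix w
    show "w \<in> alive x h \<longleftrightarrow> w \<in> (\<Union>i. Cons i ` alive (subtree i x) (h - x []))"
      using root child by (cases w) auto
  qed
qed

section \<open>Population counts of trees without explosion\<close>

text \<open>
  This is the set of configurations on which counting the living vertices is meaningful: as the next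
  lemmas show, the population is finite and nonempty at every time \<open>h \<ge> 0\<close>.
\<close>

definition nonexplosive :: "(vertex \<Rightarrow> real) \<Rightarrow> bool" where
  "nonexplosive x \<longleftrightarrow> (\<forall>w. 0 \<le> x w) \<and> (\<forall>h. finite {w. birth_time x w \<le> h})"

lemma nonexplosive_finite_alive:
  assumes "nonexplosive x"
  shows "finite (alive x h)"
proof (rule finite_subset)
  show "alive x h \<subseteq> {w. birth_time x w \<le> h}"
    by (auto simp: alive_def)
  show "finite {w. birth_time x w \<le> h}"
    using assms by (simp add: nonexplosive_def)
qed

text \<open>
  Among the finitely many vertices born up to time \<open>h\<close>, one of maximal depth has no child born
  by then, hence has not yet branched.
\<close>

lemma nonexplosive_alive_nonempty:
  assumes "nonexplosive x" "0 \<le> h"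
  shows "alive x h \<noteq> {}"
proof -
  define B where "B = {w. birth_time x w \<le> h}"
  have "finite B" "[] \<in> B"
    using assms by (auto simp: B_def nonexplosive_def birth_time_root)
  then have "Max (length ` B) \<in> length ` B"
    by (intro Max_in) auto
  then obtain w where w: "w \<in> B" "length w = Max (length ` B)"
    by auto
  have longest: "length u \<le> length w" if "u \<in> B" for u
    using \<open>finite B\<close> that by (simp add: w)
  have "w @ [False] \<notin> B"
    using longest[of "w @ [False]"] by auto
  then have "w \<in> alive x h"
    using w(1) by (auto simp: B_def alive_def birth_time_child)
  then show ?thesis by auto
qed

text \<open>
  The living vertices are shared out between the two subtrees, so \<open>n = n\<^sub>0 + n\<^sub>1\<close>. As both
  subtrees have living vertices, the truncated subtractions are genuine and
  \<open>n - 1 = 1 + (n\<^sub>0 - 1) + (n\<^sub>1 - 1)\<close>. This identity is the source of the factor \<open>\<sigma>\<close> and of the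
  square of \<open>v\<^sub>\<sigma>\<close> in the density of the first branching time.
\<close>

lemma num_alive_after_branching:
  assumes "nonexplosive (subtree False x)" "nonexplosive (subtree True x)" "x [] \<le> h"
  shows "num_alive x h - 1 =
    Suc ((num_alive (subtree False x) (h - x []) - 1) + (num_alive (subtree True x) (h - x []) - 1))"
proof -
  let ?A = "\<lambda>i. alive (subtree i x) (h - x [])"
  have fin: "finite (?A i)" and ne: "card (?A i) > 0" for i
    using assms nonexplosive_finite_alive[of "subtree i x"] nonexplosive_alive_nonempty[of "subtree i x"]
    by (cases i; auto simp: card_gt_0_iff)+
  have "alive x h = Cons False ` ?A False \<union> Cons True ` ?A True"
    using alive_after_branching[of x h] assms(3) by (simp add: UNIV_bool)
  then have "num_alive x h = card (Cons False ` ?A False) + card (Cons True ` ?A True)"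
    unfolding num_alive_def using fin by (simp only:) (rule card_Un_disjoint, auto)
  then show ?thesis
    using ne[of False] ne[of True] by (simp add: num_alive_def card_image)
qed

section \<open>The law of the waiting times and its branching decomposition\<close>

abbreviation exp_law :: "real measure" where
  "exp_law \<equiv> density lborel (exponential_density 1)"

definition tree_law :: "(vertex \<Rightarrow> real) measure" where
  "tree_law = Pi\<^sub>M UNIV (\<lambda>_. exp_law)"

lemma sets_tree_law [measurable_cong, simp]: "sets tree_law = sets (Pi\<^sub>M UNIV (\<lambda>_. borel))"
  unfolding tree_law_def by (intro sets_PiM_cong) auto

lemma space_tree_law [simp]: "space tree_law = UNIV"
  by (simp add: tree_law_def space_PiM)

interpretation exp_law: prob_space exp_law
  by (rule prob_space_exponential_density) simp

interpretation tree_law: prob_space tree_law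
  unfolding tree_law_def by (intro prob_space_PiM exp_law.prob_space_axioms)

interpretation tree_pair: pair_prob_space tree_law tree_law ..
interpretation root_and_trees: pair_prob_space exp_law "tree_law \<Otimes>\<^sub>M tree_law" ..

lemma sigma_finite_tree_pair: "sigma_finite_measure (tree_law \<Otimes>\<^sub>M tree_law)"
  by (intro prob_space_imp_sigma_finite prob_space_pair tree_law.prob_space_axioms)

lemma measurable_vertex [measurable]: "(\<lambda>x. x w) \<in> borel_measurable tree_law"
  by (subst measurable_cong_sets[OF sets_tree_law refl]) simp

lemma measurable_subtree [measurable]: "subtree i \<in> tree_law \<rightarrow>\<^sub>M tree_law"
  unfolding measurable_cong_sets[OF sets_tree_law sets_tree_law] subtree_def
  by (rule measurable_PiM_single') auto

lemma measurable_graft [measurable (raw)]: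
  assumes "a \<in> borel_measurable N" "f \<in> N \<rightarrow>\<^sub>M tree_law" "g \<in> N \<rightarrow>\<^sub>M tree_law"
  shows "(\<lambda>z. graft (a z) (f z) (g z)) \<in> N \<rightarrow>\<^sub>M tree_law"
proof -
  have "(\<lambda>z. graft (a z) (f z) (g z) w) \<in> borel_measurable N" for w
  proof (cases w)
    case (Cons i u)
    then show ?thesis
      using assms(2,3)[THEN measurable_compose, OF measurable_vertex] by (cases i) simp_all
  qed (simp add: assms(1))
  then show ?thesis
    unfolding measurable_cong_sets[OF refl sets_tree_law]
    by (intro measurable_PiM_single') auto
qed

lemma tree_box_eq_prod_emb:
  "prod_emb UNIV (\<lambda>_. exp_law) J (Pi\<^sub>E J A) = {x. \<forall>w\<in>J. x w \<in> A w}"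
  by (auto simp: prod_emb_def PiE_iff)

lemma
  assumes "finite J" "\<And>w. w \<in> J \<Longrightarrow> A w \<in> sets borel"
  shows sets_tree_box: "{x. \<forall>w\<in>J. x w \<in> A w} \<in> sets tree_law"
    and emeasure_tree_box: "emeasure tree_law {x. \<forall>w\<in>J. x w \<in> A w} = (\<Prod>w\<in>J. emeasure exp_law (A w))"
  unfolding tree_law_def tree_box_eq_prod_emb[symmetric] using assms
  by (auto intro!: sets_PiM_I emeasure_PiM_emb exp_law.prob_space_axioms)

text \<open>
  The branching property of the waiting times: the root and the two subtrees are independent, and
  each subtree is distributed as the whole tree. On a box with finitely many constraints, the
  constraints fall into those at the root and those in each subtree, and so do the factors of the
  product measure; boxes determine the product measure.
\<close>

lemma distr_graft:
  "distr (exp_law \<Otimes>\<^sub>M (tree_law \<Otimes>\<^sub>M tree_law)) tree_law (\<lambda>(s, x, y). graft s x y) = tree_law"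
  (is "distr ?P _ ?G = _")
proof -
  interpret product_prob_space "\<lambda>_. exp_law" "UNIV :: vertex set" ..
  have "distr ?P tree_law ?G = Pi\<^sub>M UNIV (\<lambda>_. exp_law)"
  proof (rule PiM_eq)
    fix J :: "vertex set" and A
    assume J: "finite J" and A: "\<And>w. w \<in> J \<Longrightarrow> A w \<in> sets exp_law"
    (* the constraints at the root (at most one), and those in the subtree i, indexed by its own vertices *)
    define K where "K i = Cons i -` J" for i
    define R where "R = J \<inter> {[]}"
    have fin: "finite (K i)" "finite R" for i
      using J by (auto simp: K_def R_def intro: finite_vimageI)
    have J_split: "J = R \<union> (Cons False ` K False \<union> Cons True ` K True)"
    proof (rule set_eqI)
      fix w show "w \<in> J \<longleftrightarrow> w \<in> R \<union> (Cons False ` K False \<union> Cons True ` K True)"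
        by (cases w) (auto simp: K_def R_def image_iff intro: bool.exhaust)
    qed
    define B where "B = {s. \<forall>w\<in>R. s \<in> A w}"
    define C where "C i = {x. \<forall>w\<in>K i. x w \<in> A (i # w)}" for i
    have R_cases: "R = {} \<or> R = {[]}" by (auto simp: R_def)
    have B: "B \<in> sets borel"
      using A R_cases by (auto simp: B_def R_def)
    have C: "C i \<in> sets tree_law" for i
      unfolding C_def using fin A by (intro sets_tree_box) (auto simp: K_def)
    have G: "?G \<in> ?P \<rightarrow>\<^sub>M tree_law"
      unfolding split_beta by measurable
    have emeasure_B: "emeasure exp_law B = (\<Prod>w\<in>R. emeasure exp_law (A w))"
      using R_cases exp_law.emeasure_space_1 by (auto simp: B_def)
    have emeasure_C: "emeasure tree_law (C i) = (\<Prod>w\<in>Cons i ` K i. emeasure exp_law (A w))" for i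
      unfolding C_def using fin A by (subst emeasure_tree_box) (auto simp: K_def prod.reindex simp del: image_vimage_eq)
    have "emeasure (distr ?P tree_law ?G) (prod_emb UNIV (\<lambda>_. exp_law) J (Pi\<^sub>E J A)) =
      emeasure ?P (?G -` prod_emb UNIV (\<lambda>_. exp_law) J (Pi\<^sub>E J A) \<inter> space ?P)"
      unfolding tree_box_eq_prod_emb using J A by (intro emeasure_distr G sets_tree_box) auto
    also have "?G -` prod_emb UNIV (\<lambda>_. exp_law) J (Pi\<^sub>E J A) \<inter> space ?P = B \<times> (C False \<times> C True)"
    proof -
      have "(\<forall>w\<in>J. graft s x y w \<in> A w) \<longleftrightarrow> s \<in> B \<and> x \<in> C False \<and> y \<in> C True" for s x y
        by (subst J_split) (auto simp: B_def C_def ball_Un R_def)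
      then show ?thesis
        by (auto simp: tree_box_eq_prod_emb space_pair_measure)
    qed
    also have "emeasure ?P \<dots> = emeasure exp_law B * (emeasure tree_law (C False) * emeasure tree_law (C True))"
      using B C by (simp add: sigma_finite_measure.emeasure_pair_measure_Times[OF sigma_finite_tree_pair] tree_law.emeasure_pair_measure_Times)
    also have "\<dots> = (\<Prod>w\<in>R \<union> (Cons False ` K False \<union> Cons True ` K True). emeasure exp_law (A w))"
    proof -
      have "Cons False ` K False \<inter> Cons True ` K True = {}"
        "R \<inter> (Cons False ` K False \<union> Cons True ` K True) = {}"
        by (auto simp: R_def)
      then show ?thesis
        unfolding emeasure_B emeasure_C using fin by (simp add: prod.union_disjoint)
    qed
    also have "R \<union> (Cons False ` K False \<union> Cons True ` K True) = J"
      by (rule J_split[symmetric])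
    finally show "emeasure (distr ?P tree_law ?G) (prod_emb UNIV (\<lambda>_. exp_law) J (Pi\<^sub>E J A)) =
      (\<Prod>w\<in>J. emeasure exp_law (A w))" .
  qed (simp add: tree_law_def)
  then show ?thesis by (simp add: tree_law_def)
qed

lemma nn_integral_tree_law:
  assumes [measurable]: "f \<in> borel_measurable tree_law"
  shows "(\<integral>\<^sup>+x. f x \<partial>tree_law) = (\<integral>\<^sup>+s. \<integral>\<^sup>+x. \<integral>\<^sup>+y. f (graft s x y) \<partial>tree_law \<partial>tree_law \<partial>exp_law)"
proof -
  have "(\<integral>\<^sup>+x. f x \<partial>tree_law) =
    (\<integral>\<^sup>+z. f (case z of (s, x, y) \<Rightarrow> graft s x y) \<partial>(exp_law \<Otimes>\<^sub>M (tree_law \<Otimes>\<^sub>M tree_law)))"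
    by (subst distr_graft[symmetric], subst nn_integral_distr) auto
  also have "\<dots> = (\<integral>\<^sup>+s. \<integral>\<^sup>+z. f (graft s (fst z) (snd z)) \<partial>(tree_law \<Otimes>\<^sub>M tree_law) \<partial>exp_law)"
    by (subst sigma_finite_measure.nn_integral_fst[OF sigma_finite_tree_pair, symmetric]) (auto simp: split_beta)
  also have "\<dots> = (\<integral>\<^sup>+s. \<integral>\<^sup>+x. \<integral>\<^sup>+y. f (graft s x y) \<partial>tree_law \<partial>tree_law \<partial>exp_law)"
  proof (rule nn_integral_cong)
    fix s :: real
    show "(\<integral>\<^sup>+z. f (graft s (fst z) (snd z)) \<partial>(tree_law \<Otimes>\<^sub>M tree_law)) =
        (\<integral>\<^sup>+x. \<integral>\<^sup>+y. f (graft s x y) \<partial>tree_law \<partial>tree_law)"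
      by (subst tree_law.nn_integral_fst[symmetric]) auto
  qed
  finally show ?thesis .
qed

section \<open>Almost sure absence of explosion\<close>

lemma measurable_birth_time [measurable (raw)]:
  assumes "f \<in> N \<rightarrow>\<^sub>M tree_law"
  shows "(\<lambda>z. birth_time (f z) w) \<in> borel_measurable N"
  unfolding birth_time_def
  using assms[THEN measurable_compose, OF measurable_vertex] by (intro borel_measurable_sum)

lemma exp_law_laplace: "(\<integral>\<^sup>+s. ennreal (exp (- 2 * s)) \<partial>exp_law) = ennreal (1 / 3)"
proof -
  interpret rate3: prob_space "density lborel (exponential_density 3)"
    by (rule prob_space_exponential_density) simp
  (* exp (- 2 s) times the density of rate 1 is a third of the density of rate 3, of total mass 1 *)
  have "(\<integral>\<^sup>+s. ennreal (exp (- 2 * s)) \<partial>exp_law) =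
      (\<integral>\<^sup>+s. ennreal (1 / 3) * ennreal (exponential_density 3 s) \<partial>lborel)"
    by (subst nn_integral_density)
      (auto intro!: nn_integral_cong simp: exponential_density_def ennreal_mult[symmetric] exp_add[symmetric])
  also have "\<dots> = ennreal (1 / 3) * emeasure (density lborel (exponential_density 3)) UNIV"
    by (simp add: nn_integral_cmult emeasure_density)
  finally show ?thesis
    using rate3.emeasure_space_1 by simp
qed

text \<open>
  A vertex of generation \<open>k\<close> is born after \<open>k\<close> independent standard exponential times; the
  branching decomposition peels them off one at a time. With an exponent \<open>- \<theta> * b\<close> the factor per
  generation is \<open>1 / (1 + \<theta>)\<close>, which beats the doubling of the number of vertices as soon as
  \<open>\<theta> > 1\<close>; here \<open>\<theta> = 2\<close>.
\<close>

lemma birth_time_laplace: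
  "(\<integral>\<^sup>+x. ennreal (exp (- 2 * birth_time x w)) \<partial>tree_law) = ennreal (1 / 3) ^ length w"
proof (induction w)
  case Nil
  then show ?case
    using tree_law.emeasure_space_1 by (simp add: birth_time_root)
next
  case (Cons i w)
  let ?L = "\<lambda>x. ennreal (exp (- 2 * birth_time x w))"
  have "(\<integral>\<^sup>+x. ennreal (exp (- 2 * birth_time x (i # w))) \<partial>tree_law) =
      (\<integral>\<^sup>+s. \<integral>\<^sup>+x. \<integral>\<^sup>+y. ennreal (exp (- 2 * s)) * ?L (if i then y else x) \<partial>tree_law \<partial>tree_law \<partial>exp_law)"
    by (subst nn_integral_tree_law)
      (cases i; simp add: birth_time_Cons ennreal_mult[symmetric] exp_add[symmetric] distrib_left)+
  also have "\<dots> = (\<integral>\<^sup>+s. ennreal (exp (- 2 * s)) * (\<integral>\<^sup>+x. ?L x \<partial>tree_law) \<partial>exp_law)"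
    using tree_law.emeasure_space_1 by (cases i) (simp_all add: nn_integral_cmult)
  also have "\<dots> = ennreal (1 / 3) ^ length (i # w)"
    by (simp add: nn_integral_multc exp_law_laplace[simplified] Cons.IH[simplified])
  finally show ?case .
qed

lemma AE_nonneg: "AE x in tree_law. \<forall>w. 0 \<le> x w"
proof -
  interpret product_prob_space "\<lambda>_. exp_law" "UNIV :: vertex set" ..
  have "AE s in exp_law. 0 \<le> s"
    by (subst AE_density) (auto simp: exponential_density_def)
  then have "AE x in tree_law. 0 \<le> x w" for w
    unfolding tree_law_def by (intro AE_component) auto
  then show ?thesis
    by (simp add: AE_all_countable)
qed

text \<open>
  The \<open>2 ^ k\<close> vertices of generation \<open>k\<close> contribute \<open>(2 / 3) ^ k\<close> to the expectation of the sum of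
  \<open>exp (- 2 b\<^sub>w)\<close>, where \<open>b\<^sub>w\<close> is the birth time of \<open>w\<close>. Hence this sum is almost surely finite.
  A vertex born before \<open>h\<close> contributes at least \<open>exp (- 2 h)\<close> to it, so no generation beyond a
  random one contains such a vertex. The exceptional null set does not depend on \<open>h\<close>, so the
  same null set serves the random residual horizon left after the first branching.
\<close>

lemma AE_nonexplosive: "AE x in tree_law. nonexplosive x"
proof -
  define z where "z k x = (\<Sum>w | length w = k. exp (- 2 * birth_time x w))" for k :: nat and x
  have fin: "finite {w :: vertex. length w = k}" for k
    using finite_lists_length_eq[of "UNIV :: bool set" k] by simp
  have card: "card {w :: vertex. length w = k} = 2 ^ k" for k
    using card_lists_length_eq[of "UNIV :: bool set" k] by simp
  have z_nonneg: "0 \<le> z k x" for k x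
    by (auto simp: z_def intro: sum_nonneg)
  have [measurable]: "z k \<in> borel_measurable tree_law" for k
    unfolding z_def by measurable
  have "(\<integral>\<^sup>+x. ennreal (z k x) \<partial>tree_law) = ennreal ((2 / 3) ^ k)" for k
  proof -
    have "(\<integral>\<^sup>+x. ennreal (z k x) \<partial>tree_law) =
        (\<Sum>w | length w = k. \<integral>\<^sup>+x. ennreal (exp (- 2 * birth_time x w)) \<partial>tree_law)"
      unfolding z_def by (subst nn_integral_sum[symmetric]) (auto simp: sum_ennreal)
    also have "\<dots> = ennreal (2 ^ k * (1 / 3) ^ k)"
      by (simp only: birth_time_laplace)
        (simp add: card ennreal_power ennreal_mult flip: ennreal_numeral)
    also have "(2 ^ k * (1 / 3) ^ k :: real) = (2 / 3) ^ k"
      by (simp add: power_divide)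
    finally show ?thesis .
  qed
  then have "(\<integral>\<^sup>+x. (\<Sum>k. ennreal (z k x)) \<partial>tree_law) = (\<Sum>k. ennreal ((2 / 3) ^ k))"
    by (subst nn_integral_suminf) auto
  also have "\<dots> = ennreal (\<Sum>k. (2 / 3) ^ k)"
    by (intro suminf_ennreal2 summable_geometric) auto
  finally have "AE x in tree_law. (\<Sum>k. ennreal (z k x)) \<noteq> \<infinity>"
    by (intro nn_integral_PInf_AE) auto
  then show ?thesis
    using AE_nonneg
  proof eventually_elim
    case (elim x)
    have "summable (\<lambda>k. z k x)"
      using elim(1) z_nonneg by (intro summable_suminf_not_top) (auto simp: top_ennreal_def)
    then have lim: "(\<lambda>k. z k x) \<longlonglongrightarrow> 0"
      by (rule summable_LIMSEQ_zero)
    have "finite {w. birth_time x w \<le> h}" for h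
    proof -
      have "eventually (\<lambda>k. z k x < exp (- 2 * h)) sequentially"
        using order_tendstoD(2)[OF lim] by simp
      then obtain K where K: "\<And>k. K \<le> k \<Longrightarrow> z k x < exp (- 2 * h)"
        by (auto simp: eventually_sequentially)
      have "length w < K" if "birth_time x w \<le> h" for w
      proof (rule ccontr)
        assume "\<not> length w < K"
        then have "z (length w) x < exp (- 2 * h)"
          by (intro K) simp
        moreover have "exp (- 2 * birth_time x w) \<le> z (length w) x"
          unfolding z_def using fin by (intro member_le_sum) auto
        ultimately have "- 2 * birth_time x w < - 2 * h"
          by (metis exp_less_cancel_iff order_le_less_trans)
        then show False using that by simp
      qed
      then have "{w. birth_time x w \<le> h} \<subseteq> (\<Union>k<K. {w. length w = k})"
        by auto
      then show ?thesis
        using fin by (meson finite_UN_I finite_lessThan finite_subset)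
    qed
    then show ?case
      using elim(2) by (simp add: nonexplosive_def)
  qed
qed

section \<open>The first branching under exponential tilting\<close>

text \<open>
  The residual horizon of the subtrees depends on the first branching time, so the population size
  has to be measurable jointly in the tree and in the time.
\<close>

lemma measurable_num_alive [measurable (raw)]:
  assumes [measurable]: "f \<in> N \<rightarrow>\<^sub>M tree_law" "g \<in> borel_measurable N"
  shows "(\<lambda>z. num_alive (f z) (g z)) \<in> N \<rightarrow>\<^sub>M count_space UNIV"
proof -
  have [measurable]: "(\<lambda>z. f z w) \<in> borel_measurable N" for w
    using assms(1)[THEN measurable_compose, OF measurable_vertex] .
  (* vertices are numbered so that the measurability of cardinalities of sets of naturals applies *)
  have "num_alive x h = card (to_nat ` alive x h)" for x h
    by (simp add: num_alive_def card_image inj_on_def)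
  moreover have "(\<lambda>z. card (to_nat ` alive (f z) (g z))) \<in> N \<rightarrow>\<^sub>M count_space UNIV"
  proof (rule measurable_card)
    fix n
    have "{z \<in> space N. n \<in> to_nat ` alive (f z) (g z)} =
        {z \<in> space N. \<exists>w. to_nat w = n \<and> birth_time (f z) w \<le> g z \<and> g z < birth_time (f z) w + f z w}"
      by (auto simp: alive_def)
    also have "\<dots> \<in> sets N"
      by measurable
    finally show "{z \<in> space N. n \<in> to_nat ` alive (f z) (g z)} \<in> sets N" .
  qed
  ultimately show ?thesis by simp
qed

text \<open>
  The identity behind the quasi-Markov property, with arbitrary nonnegative functions of the two
  subtrees: given that the root branches at time \<open>s \<le> h\<close>, the weight \<open>\<sigma> ^ (n - 1)\<close> at time \<open>h\<close> is
  \<open>\<sigma>\<close> times the product of the weights of the two subtrees at time \<open>h - s\<close>, and the subtrees are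
  independent.
\<close>

lemma nn_integral_branching:
  fixes \<sigma> :: ennreal
  assumes [measurable]: "f \<in> borel_measurable tree_law" "g \<in> borel_measurable tree_law"
    and "r \<le> h"
  shows "(\<integral>\<^sup>+x. indicator {..r} (x []) * f (subtree False x) * g (subtree True x) *
        \<sigma> ^ (num_alive x h - 1) \<partial>tree_law) =
    (\<integral>\<^sup>+s. indicator {..r} s * \<sigma> *
        (\<integral>\<^sup>+x. f x * \<sigma> ^ (num_alive x (h - s) - 1) \<partial>tree_law) *
        (\<integral>\<^sup>+y. g y * \<sigma> ^ (num_alive y (h - s) - 1) \<partial>tree_law) \<partial>exp_law)"
proof -
  let ?F = "\<lambda>s x. f x * \<sigma> ^ (num_alive x (h - s) - 1)"
  let ?G = "\<lambda>s x. g x * \<sigma> ^ (num_alive x (h - s) - 1)"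
  have "(\<integral>\<^sup>+x. indicator {..r} (x []) * f (subtree False x) * g (subtree True x) *
        \<sigma> ^ (num_alive x h - 1) \<partial>tree_law) =
    (\<integral>\<^sup>+s. \<integral>\<^sup>+x. \<integral>\<^sup>+y. indicator {..r} s * f x * g y *
        \<sigma> ^ (num_alive (graft s x y) h - 1) \<partial>tree_law \<partial>tree_law \<partial>exp_law)"
    by (subst nn_integral_tree_law) simp_all
  also have "\<dots> = (\<integral>\<^sup>+s. \<integral>\<^sup>+x. \<integral>\<^sup>+y. indicator {..r} s * \<sigma> * ?F s x * ?G s y
        \<partial>tree_law \<partial>tree_law \<partial>exp_law)"
  proof (rule nn_integral_cong)
    fix s :: real
    show "(\<integral>\<^sup>+x. \<integral>\<^sup>+y. indicator {..r} s * f x * g y *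
        \<sigma> ^ (num_alive (graft s x y) h - 1) \<partial>tree_law \<partial>tree_law) =
      (\<integral>\<^sup>+x. \<integral>\<^sup>+y. indicator {..r} s * \<sigma> * ?F s x * ?G s y \<partial>tree_law \<partial>tree_law)"
    proof (rule nn_integral_cong_AE)
      have "AE y in tree_law. indicator {..r} s * f x * g y * \<sigma> ^ (num_alive (graft s x y) h - 1) =
          indicator {..r} s * \<sigma> * ?F s x * ?G s y" if "nonexplosive x" for x
        using AE_nonexplosive
      proof eventually_elim
        case (elim y)
        show ?case
        proof (cases "s \<le> r")
          case True
          then show ?thesis
            using num_alive_after_branching[of "graft s x y" h] that elim \<open>r \<le> h\<close>
            by (simp add: power_add ac_simps)
        qed simp
      qed
      then show "AE x in tree_law. (\<integral>\<^sup>+y. indicator {..r} s * f x * g y *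
          \<sigma> ^ (num_alive (graft s x y) h - 1) \<partial>tree_law) =
        (\<integral>\<^sup>+y. indicator {..r} s * \<sigma> * ?F s x * ?G s y \<partial>tree_law)"
        using AE_nonexplosive by (auto elim!: eventually_mono intro!: nn_integral_cong_AE)
    qed
  qed
  also have "\<dots> = (\<integral>\<^sup>+s. indicator {..r} s * \<sigma> *
        (\<integral>\<^sup>+x. ?F s x \<partial>tree_law) * (\<integral>\<^sup>+y. ?G s y \<partial>tree_law) \<partial>exp_law)"
    by (simp add: nn_integral_cmult nn_integral_multc)
  finally show ?thesis .
qed

text \<open>
  The numerator of \<^const>\<open>P_hat\<close>, expressed under the law of the waiting times; for the whole
  space it is \<^const>\<open>v_fun\<close>.
\<close>

definition tilted_mass :: "real \<Rightarrow> real \<Rightarrow> (vertex \<Rightarrow> real) set \<Rightarrow> real" where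
  "tilted_mass \<sigma> h A = (\<integral>x. indicator A x * \<sigma> ^ (num_alive x h - 1) \<partial>tree_law)"

context
  fixes \<sigma> :: real
  assumes \<sigma>: "0 \<le> \<sigma>" "\<sigma> \<le> 1"
begin

lemma integrable_weight:
  assumes [measurable]: "A \<in> sets tree_law"
  shows "integrable tree_law (\<lambda>x. indicator A x * \<sigma> ^ (num_alive x h - 1))"
  using \<sigma> by (intro tree_law.integrable_const_bound[where B = 1])
    (auto simp: abs_mult power_le_one indicator_def)

lemma tilted_mass_nonneg: "0 \<le> tilted_mass \<sigma> h A"
  unfolding tilted_mass_def using \<sigma> by (intro integral_nonneg_AE) auto

lemma tilted_mass_le_UNIV:
  assumes "A \<in> sets tree_law"
  shows "tilted_mass \<sigma> h A \<le> tilted_mass \<sigma> h UNIV"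
  unfolding tilted_mass_def using assms \<sigma> sets.top[of tree_law]
  by (intro integral_mono integrable_weight) (auto simp: indicator_def)

lemma ennreal_tilted_mass:
  assumes "A \<in> sets tree_law"
  shows "ennreal (tilted_mass \<sigma> h A) =
    (\<integral>\<^sup>+x. indicator A x * ennreal \<sigma> ^ (num_alive x h - 1) \<partial>tree_law)"
  unfolding tilted_mass_def using \<sigma>
  by (subst nn_integral_eq_integral[symmetric, OF integrable_weight[OF assms]])
    (auto intro!: nn_integral_cong simp: ennreal_mult ennreal_power split: split_indicator)

lemma measurable_tilted_mass [measurable]:
  assumes [measurable]: "A \<in> sets tree_law"
  shows "(\<lambda>h. tilted_mass \<sigma> h A) \<in> borel_measurable borel"
  unfolding tilted_mass_def by measurable

text \<open>
  The identity \<open>nn_integral_branching\<close> for indicator functions, with the exponential law of the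
  first branching time written as \<open>exp (- s) ds\<close>. Both sides are computed as extended nonnegative
  integrals and turned into real numbers only at the end, which spares a separate integrability
  proof for the integrand on the right.
\<close>

lemma tilted_mass_branching:
  assumes [measurable]: "A0 \<in> sets tree_law" "A1 \<in> sets tree_law" and "r \<le> h"
  shows "tilted_mass \<sigma> h {x. x [] \<le> r \<and> subtree False x \<in> A0 \<and> subtree True x \<in> A1} =
    (\<integral>s. indicator {0..r} s * (exp (- s) * \<sigma> *
      tilted_mass \<sigma> (h - s) A0 * tilted_mass \<sigma> (h - s) A1) \<partial>lborel)"
  (is "tilted_mass \<sigma> h ?A = integral\<^sup>L lborel ?f")
proof -
  have A: "?A \<in> sets tree_law"
  proof -
    have "{x \<in> space tree_law. x [] \<le> r \<and> subtree False x \<in> A0 \<and> subtree True x \<in> A1} \<in> sets tree_law"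
      by measurable
    then show ?thesis by simp
  qed
  have "ennreal (tilted_mass \<sigma> h ?A) =
    (\<integral>\<^sup>+x. indicator {..r} (x []) * indicator A0 (subtree False x) * indicator A1 (subtree True x) *
        ennreal \<sigma> ^ (num_alive x h - 1) \<partial>tree_law)"
    unfolding ennreal_tilted_mass[OF A]
    by (intro nn_integral_cong) (auto split: split_indicator)
  also have "\<dots> = (\<integral>\<^sup>+s. indicator {..r} s * ennreal \<sigma> *
      ennreal (tilted_mass \<sigma> (h - s) A0) * ennreal (tilted_mass \<sigma> (h - s) A1) \<partial>exp_law)"
    unfolding ennreal_tilted_mass[OF assms(1)] ennreal_tilted_mass[OF assms(2)]
    by (rule nn_integral_branching) (measurable, fact)
  also have "\<dots> = (\<integral>\<^sup>+s. ennreal (?f s) \<partial>lborel)"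
    using \<sigma> tilted_mass_nonneg
    by (subst nn_integral_density)
      (auto intro!: nn_integral_cong simp: exponential_density_def ennreal_mult mult_ac split: split_indicator)
  finally have mass: "ennreal (tilted_mass \<sigma> h ?A) = (\<integral>\<^sup>+s. ennreal (?f s) \<partial>lborel)" .
  have "tilted_mass \<sigma> h ?A = enn2real (\<integral>\<^sup>+s. ennreal (?f s) \<partial>lborel)"
    unfolding mass[symmetric] using tilted_mass_nonneg by (rule enn2real_ennreal[symmetric])
  also have "\<dots> = integral\<^sup>L lborel ?f"
    using \<sigma> tilted_mass_nonneg by (intro integral_eq_nn_integral[symmetric]) auto
  finally show ?thesis .
qed

end

section \<open>Quasi-Markov branching times\<close>

text \<open>
  Sets of nonnegative families can thus be measured by the law on all real families. The
  nonnegative families themselves form a measurable set because there are only countably many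
  vertices.
\<close>

lemma sets_waiting_space_subset: "sets waiting_space \<subseteq> sets tree_law"
proof -
  let ?N = "\<lambda>_ :: vertex. restrict_space borel {0 :: real..}"
  have space: "space (Pi\<^sub>M UNIV ?N) \<in> sets tree_law"
  proof -
    have "space (Pi\<^sub>M UNIV ?N) = {x \<in> space tree_law. \<forall>w. 0 \<le> x w}"
      by (auto simp: space_PiM space_restrict_space PiE_iff)
    also have "\<dots> \<in> sets tree_law"
      by measurable
    finally show ?thesis .
  qed
  have "{f \<in> space (Pi\<^sub>M UNIV ?N). f w \<in> A} \<in> sets tree_law" if "A \<in> sets (?N w)" for w A
  proof -
    from that have [measurable]: "A \<in> sets borel"
      by (auto simp: sets_restrict_space)
    have "{f \<in> space (Pi\<^sub>M UNIV ?N). f w \<in> A} = space (Pi\<^sub>M UNIV ?N) \<inter> {f \<in> space tree_law. f w \<in> A}"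
      by auto
    also have "\<dots> \<in> sets tree_law"
      by (intro sets.Int space) measurable
    finally show ?thesis .
  qed
  then show ?thesis
    using space unfolding waiting_space_def sets_PiM_single
    by (intro sets.sigma_sets_subset') (auto simp: space_PiM)
qed

theorem lemma4p1:
  fixes M :: "'a measure" and e :: "vertex \<Rightarrow> 'a \<Rightarrow> real"
    and l \<epsilon> t T r :: real and q :: "real measure"
    and A0 A1 :: "(vertex \<Rightarrow> real) set"
  defines "\<sigma> \<equiv> sigma_param l \<epsilon>"
  assumes "prob_space M"
    and "prob_space.indep_vars M (\<lambda>_. borel) e UNIV"
    and "\<And>w. distributed M lborel (e w) (exponential_density 1)"
    and "l \<ge> 0" and "\<epsilon> > 0" and "T \<le> t"
    and "prob_space q" and "sets q = sets borel"
    and "restrict_space q {0..t - T} =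
      density (restrict_space lborel {0..t - T})
        (\<lambda>s. ennreal (exp (- s) * \<sigma> * (v_fun M e \<sigma> (t - T - s))\<^sup>2 / v_fun M e \<sigma> (t - T)))"
    and "0 \<le> r" and "r \<le> t - T"
    and "A0 \<in> sets waiting_space" and "A1 \<in> sets waiting_space"
  shows "P_hat M e l \<epsilon> (t - T)
      {\<omega> \<in> space M. e [] \<omega> \<le> r \<and> (\<lambda>w. e (False # w) \<omega>) \<in> A0 \<and> (\<lambda>w. e (True # w) \<omega>) \<in> A1} =
    (LINT s:{0..r}|q.
      P_hat M e l \<epsilon> (t - T - s) {\<omega> \<in> space M. (\<lambda>w. e w \<omega>) \<in> A0} *
      P_hat M e l \<epsilon> (t - T - s) {\<omega> \<in> space M. (\<lambda>w. e w \<omega>) \<in> A1})"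
proof -
  interpret prob_space M by fact
  define X where "X \<omega> w = e w \<omega>" for \<omega> w
  define h where "h = t - T"
  define F where "F = tilted_mass \<sigma>"
  define V where "V u = F u UNIV" for u
  have \<sigma>: "0 \<le> \<sigma>" "\<sigma> \<le> 1"
    by (simp_all add: \<sigma>_def sigma_param_def cosh_real_ge_1 cosh_real_pos field_simps)

  have rv: "e w \<in> borel_measurable M" for w
    using distributed_measurable[OF assms(4)] by simp
  have X [measurable]: "X \<in> M \<rightarrow>\<^sub>M tree_law"
    unfolding measurable_cong_sets[OF refl sets_tree_law] X_def
    by (rule measurable_PiM_single') (auto intro: rv)
  have "distr M borel (e w) = exp_law" for w
    using distributed_distr_eq_density[OF assms(4)] by (simp cong: distr_cong)
  then have "distr M (Pi\<^sub>M UNIV (\<lambda>_. borel)) X = tree_law"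
    using indep_vars_iff_distr_eq_PiM[where I = UNIV and M' = "\<lambda>_. borel" and X = e] rv assms(3)
    by (simp add: tree_law_def X_def[abs_def] restrict_UNIV)
  then have law: "distr M tree_law X = tree_law"
    by (metis distr_cong sets_tree_law)

  have numerator: "(\<integral>\<omega>. indicator {\<omega> \<in> space M. X \<omega> \<in> A} \<omega> * \<sigma> ^ (num_alive (X \<omega>) u - 1) \<partial>M) = F u A"
    if [measurable]: "A \<in> sets tree_law" for u A
  proof -
    have "F u A = (\<integral>\<omega>. indicator A (X \<omega>) * \<sigma> ^ (num_alive (X \<omega>) u - 1) \<partial>M)"
      unfolding F_def tilted_mass_def by (subst law[symmetric], subst integral_distr) auto
    also have "\<dots> = (\<integral>\<omega>. indicator {\<omega> \<in> space M. X \<omega> \<in> A} \<omega> * \<sigma> ^ (num_alive (X \<omega>) u - 1) \<partial>M)"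
      by (intro Bochner_Integration.integral_cong) (auto simp: indicator_def)
    finally show ?thesis ..
  qed
  have v: "v_fun M e \<sigma> u = V u" for u
  proof -
    have "UNIV \<in> sets tree_law"
      using sets.top[of tree_law] by simp
    note numerator[OF this, of u]
    moreover have "(\<integral>\<omega>. indicator {\<omega> \<in> space M. X \<omega> \<in> UNIV} \<omega> * \<sigma> ^ (num_alive (X \<omega>) u - 1) \<partial>M) =
        v_fun M e \<sigma> u"
      unfolding v_fun_def X_def[abs_def] by (intro Bochner_Integration.integral_cong) auto
    ultimately show ?thesis by (simp add: V_def)
  qed
  have P_hat: "P_hat M e l \<epsilon> u {\<omega> \<in> space M. X \<omega> \<in> A} = F u A / V u" if "A \<in> sets tree_law" for u A
    unfolding P_hat_def \<sigma>_def[symmetric] v numerator[OF that, symmetric] by (simp add: X_def[abs_def])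

  have A [measurable]: "A0 \<in> sets tree_law" "A1 \<in> sets tree_law"
    using assms(13,14) sets_waiting_space_subset by auto
  let ?A = "{x. x [] \<le> r \<and> subtree False x \<in> A0 \<and> subtree True x \<in> A1}"
  have A_branch: "?A \<in> sets tree_law"
  proof -
    have "{x \<in> space tree_law. x [] \<le> r \<and> subtree False x \<in> A0 \<and> subtree True x \<in> A1} \<in> sets tree_law"
      by measurable
    then show ?thesis by simp
  qed
  let ?g = "\<lambda>s. (F (h - s) A0 / V (h - s)) * (F (h - s) A1 / V (h - s))"
  let ?d = "\<lambda>s. exp (- s) * \<sigma> * (V (h - s))\<^sup>2 / V h"
  have F_meas [measurable]: "(\<lambda>s. F s A) \<in> borel_measurable borel" if "A \<in> sets tree_law" for A
    unfolding F_def using measurable_tilted_mass[OF \<sigma> that] .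
  have V_meas [measurable]: "V \<in> borel_measurable borel"
    unfolding V_def[abs_def] using F_meas sets.top[of tree_law] by simp
  have V_nonneg: "0 \<le> V u" for u
    unfolding V_def F_def by (rule tilted_mass_nonneg[OF \<sigma>])
  (* If the normalisation vanishes, so does the smaller numerator; this covers division by zero. *)
  have cancel: "V u * (F u B / V u) = F u B" if "B \<in> sets tree_law" for u B
    using tilted_mass_nonneg[OF \<sigma>, of u B] tilted_mass_le_UNIV[OF \<sigma> that, of u]
    by (auto simp: V_def F_def)

  (* Only the restriction of q to {0..h} is known, so the integral is first written over that interval. *)
  have "(LINT s:{0..r}|q. ?g s) = (LINT s:{0..h}|q. indicator {0..r} s * ?g s)"
    unfolding set_lebesgue_integral_def using assms(12)
    by (intro Bochner_Integration.integral_cong) (auto simp: h_def split: split_indicator)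
  also have "\<dots> = (\<integral>s. indicator {0..r} s * ?g s \<partial>restrict_space q {0..h})"
    unfolding set_lebesgue_integral_def using assms(9)
    by (subst integral_restrict_space) (auto simp: sets_eq_imp_space_eq[OF assms(9)])
  also have "restrict_space q {0..h} = density (restrict_space lborel {0..h}) (\<lambda>s. ennreal (?d s))"
    using assms(10) by (simp add: h_def v)
  also have "(\<integral>s. indicator {0..r} s * ?g s \<partial>density (restrict_space lborel {0..h}) (\<lambda>s. ennreal (?d s))) =
      (\<integral>s. ?d s * (indicator {0..r} s * ?g s) \<partial>restrict_space lborel {0..h})"
    using \<sigma> V_nonneg A by (subst integral_density) (auto intro!: measurable_restrict_space1)
  also have "\<dots> = (\<integral>s. indicator {0..h} s * (?d s * (indicator {0..r} s * ?g s)) \<partial>lborel)"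
    by (subst integral_restrict_space) auto
  also have "\<dots> = (\<integral>s. indicator {0..r} s * (exp (- s) * \<sigma> * F (h - s) A0 * F (h - s) A1) / V h \<partial>lborel)"
  proof (intro Bochner_Integration.integral_cong refl)
    fix s :: real
    have "?d s * ?g s = exp (- s) * \<sigma> * (V (h - s) * (F (h - s) A0 / V (h - s))) *
        (V (h - s) * (F (h - s) A1 / V (h - s))) / V h"
      by (simp only: power2_eq_square divide_inverse mult_ac)
    then have "?d s * ?g s = exp (- s) * \<sigma> * F (h - s) A0 * F (h - s) A1 / V h"
      by (simp only: cancel A)
    then show "indicator {0..h} s * (?d s * (indicator {0..r} s * ?g s)) =
        indicator {0..r} s * (exp (- s) * \<sigma> * F (h - s) A0 * F (h - s) A1) / V h"
      using assms(12) by (auto simp: h_def split: split_indicator)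
  qed
  also have "\<dots> = F h ?A / V h"
    using tilted_mass_branching[OF \<sigma> A, of r h] assms(12) by (simp add: F_def h_def)
  finally have main: "F h ?A / V h = (LINT s:{0..r}|q. ?g s)" ..
  have "{\<omega> \<in> space M. e [] \<omega> \<le> r \<and> (\<lambda>w. e (False # w) \<omega>) \<in> A0 \<and> (\<lambda>w. e (True # w) \<omega>) \<in> A1} =
      {\<omega> \<in> space M. X \<omega> \<in> ?A}"
    by (simp add: X_def subtree_def[abs_def])
  moreover have "{\<omega> \<in> space M. (\<lambda>w. e w \<omega>) \<in> B} = {\<omega> \<in> space M. X \<omega> \<in> B}" for B
    by (simp add: X_def[abs_def])
  ultimately show ?thesis
    using main by (simp only: P_hat A A_branch flip: h_def)
qed

end
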